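(* Let $C$ be a topological space in $\mathcal{W}$, considered as a comonoid in the category $\mathcal{W}$ of compactly generated weakly Hausdorff spaces. Then the category $\mathcal{W}^C$ of $C$-contramodules in $\mathcal{W}$ is cocomplete.
   Context: $\mathcal{W}$ is the category of compactly generated weakly Hausdorff topological spaces and continuous maps; it is cartesian closed, with product the Kellification of the usual product and internal hom $[X,Y]$ the Kellification of the space of continuous maps with the compact-open topology. A comonoid in $\mathcal{W}$ is a space $C$ with its diagonal as comultiplication and the map to a point as counit. A $C$-contramodule is a space $X\in\mathcal{W}$ with a continuous map $\theta:[C,X]\to X$ such that $\theta$ of the constant map with value $x$ is $x$, and for every continuous $\gamma:C\times C\to X$, $\theta\big(a\mapsto\theta(\gamma(a,-))\big)=\theta\big(a\mapsto\gamma(a,a)\big)$. Morphisms are continuous maps $f:X\to Y$ with $f(\theta_X(g))=\theta_Y(f\circ g)$ for all $g\in[C,X]$. Cocomplete means having all small colimits. *)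

theory Defs
  imports "HOL-Analysis.Analysis"
begin

section \<open>Compactly generated weakly Hausdorff spaces\<close>

text \<open>
  Weak Hausdorffness and compact generation are tested against continuous maps from arbitrary
  compact Hausdorff spaces. One cannot quantify over types, so the test spaces for a space on
  \<^typ>\<open>'a\<close> live on \<^typ>\<open>'a set set\<close>. This loses nothing. Given \<open>u : K \<rightarrow> X\<close> and \<open>S \<subseteq> u ` K\<close>, let \<open>D\<close>
  consist of one preimage of each point of \<open>S\<close>, and let \<open>K'\<close> be its closure in \<open>K\<close>; then \<open>K'\<close> injects
  into \<open>Pow (Pow D)\<close> by sending a point to the traces on \<open>D\<close> of its neighbourhoods. With \<open>S = u ` K\<close>,
  the maps \<open>u\<close> and \<open>u\<close> restricted to \<open>K'\<close> have the same image, so weak Hausdorffness needs no larger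
  test spaces. Now let \<open>X\<close> be weakly Hausdorff (the only case used below), \<open>T \<subseteq> X\<close>, and let \<open>p \<in> K\<close> be
  in the closure of the preimage of \<open>T\<close> with \<open>u p \<notin> T\<close>. Take \<open>S = T \<inter> u ` K\<close>: then \<open>u ` K'\<close> is closed
  and contains \<open>S\<close>, hence contains \<open>u p\<close>, so that \<open>u p = u p'\<close> for some \<open>p' \<in> K'\<close>, which is in the
  closure of \<open>D\<close> but not in the preimage of \<open>T\<close>. So \<open>K'\<close> also shows that \<open>T\<close> is not k-closed.

  The library's \<^const>\<open>k_space\<close> and \<^const>\<open>kification\<close> are not used: they test against all compact
  subspaces, Hausdorff or not, which gives a different notion. For instance the one-point
  compactification of the rationals is compactly generated weakly Hausdorff and compact, but not Hausdorff;
  \<^const>\<open>kification\<close> leaves its square unchanged, although the diagonal is not closed there.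
\<close>

definition test_map :: "'a topology \<Rightarrow> 'a set set topology \<Rightarrow> ('a set set \<Rightarrow> 'a) \<Rightarrow> bool" where
  "test_map X K u \<longleftrightarrow> compact_space K \<and> Hausdorff_space K \<and> continuous_map K X u"

definition weakly_Hausdorff_space :: "'a topology \<Rightarrow> bool" where
  "weakly_Hausdorff_space X \<longleftrightarrow> (\<forall>K u. test_map X K u \<longrightarrow> closedin X (u ` topspace K))"

definition k_open :: "'a topology \<Rightarrow> 'a set \<Rightarrow> bool" where
  "k_open X U \<longleftrightarrow> U \<subseteq> topspace X \<and>
     (\<forall>K u. test_map X K u \<longrightarrow> openin K {k \<in> topspace K. u k \<in> U})"

definition Kellification :: "'a topology \<Rightarrow> 'a topology" where
  "Kellification X = topology (k_open X)"

definition compactly_generated_space :: "'a topology \<Rightarrow> bool" where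
  "compactly_generated_space X \<longleftrightarrow> Kellification X = X"

definition cgwh_space :: "'a topology \<Rightarrow> bool" where
  "cgwh_space X \<longleftrightarrow> compactly_generated_space X \<and> weakly_Hausdorff_space X"

lemma istopology_k_open: "istopology (k_open X)"
  unfolding istopology_def
proof (intro conjI strip)
  fix S T assume S: "k_open X S" and T: "k_open X T"
  have "openin K {k \<in> topspace K. u k \<in> S \<inter> T}" if "test_map X K u" for K u
  proof -
    have "{k \<in> topspace K. u k \<in> S \<inter> T} = {k \<in> topspace K. u k \<in> S} \<inter> {k \<in> topspace K. u k \<in> T}"
      by auto
    with S T that show ?thesis by (simp add: k_open_def openin_Int)
  qed
  with S show "k_open X (S \<inter> T)" by (auto simp: k_open_def)
next
  fix \<U> assume U: "\<forall>U\<in>\<U>. k_open X U"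
  have "openin K {k \<in> topspace K. u k \<in> \<Union>\<U>}" if "test_map X K u" for K u
  proof -
    have "{k \<in> topspace K. u k \<in> \<Union>\<U>} = (\<Union>U\<in>\<U>. {k \<in> topspace K. u k \<in> U})"
      by auto
    with U that show ?thesis by (auto simp: k_open_def intro!: openin_Union)
  qed
  with U show "k_open X (\<Union>\<U>)" by (auto simp: k_open_def)
qed

lemma openin_Kellification: "openin (Kellification X) U \<longleftrightarrow> k_open X U"
  by (simp add: Kellification_def istopology_k_open)

lemma topspace_Kellification [simp]: "topspace (Kellification X) = topspace X"
proof -
  have "k_open X (topspace X)"
    by (auto simp: k_open_def test_map_def continuous_map_def)
  moreover have "U \<subseteq> topspace X" if "k_open X U" for U
    using that by (simp add: k_open_def)
  ultimately show ?thesis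
    unfolding topspace_def [of "Kellification X"] openin_Kellification by blast
qed

definition k_prod :: "'a topology \<Rightarrow> 'b topology \<Rightarrow> ('a \<times> 'b) topology" where
  "k_prod X Y = Kellification (prod_topology X Y)"

text \<open>
  A continuous map is represented by the function that is \<^const>\<open>undefined\<close> outside the domain
  space, so that equal maps are equal as functions.
\<close>

definition maps :: "'a topology \<Rightarrow> 'b topology \<Rightarrow> ('a \<Rightarrow> 'b) set" where
  "maps X Y = {f \<in> extensional (topspace X). continuous_map X Y f}"

definition compact_open_topology :: "'a topology \<Rightarrow> 'b topology \<Rightarrow> ('a \<Rightarrow> 'b) topology" where
  "compact_open_topology X Y =
     topology_generated_by {{f \<in> maps X Y. f ` K \<subseteq> U} | K U. compactin X K \<and> openin Y U}"

lemma topspace_compact_open_topology [simp]: "topspace (compact_open_topology X Y) = maps X Y"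
proof -
  have "maps X Y \<in> {{f \<in> maps X Y. f ` K \<subseteq> U} | K U. compactin X K \<and> openin Y U}"
    by (rule CollectI, rule exI [of _ "{}"], rule exI [of _ "{}"]) auto
  then show ?thesis
    by (auto simp: compact_open_topology_def topology_generated_by_topspace)
qed

definition hom_space :: "'a topology \<Rightarrow> 'b topology \<Rightarrow> ('a \<Rightarrow> 'b) topology" where
  "hom_space X Y = Kellification (compact_open_topology X Y)"


section \<open>Contramodules\<close>

record ('c, 'x) contra_struct =
  space_of :: "'x topology"
  contra :: "('c \<Rightarrow> 'x) \<Rightarrow> 'x"

definition contramodule :: "'c topology \<Rightarrow> ('c, 'x) contra_struct \<Rightarrow> bool" where
  "contramodule C X \<longleftrightarrow>
     cgwh_space (space_of X) \<and>
     continuous_map (hom_space C (space_of X)) (space_of X) (contra X) \<and>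
     (\<forall>x \<in> topspace (space_of X). contra X (\<lambda>a \<in> topspace C. x) = x) \<and>
     (\<forall>\<gamma>. continuous_map (k_prod C C) (space_of X) \<gamma> \<longrightarrow>
        contra X (\<lambda>a \<in> topspace C. contra X (\<lambda>b \<in> topspace C. \<gamma> (a, b))) =
        contra X (\<lambda>a \<in> topspace C. \<gamma> (a, a)))"

text \<open>
  Here and below a morphism may take any values outside its domain space; morphisms are compared
  on that space only.
\<close>

definition contra_hom ::
    "'c topology \<Rightarrow> ('c, 'x) contra_struct \<Rightarrow> ('c, 'y) contra_struct \<Rightarrow> ('x \<Rightarrow> 'y) \<Rightarrow> bool" where
  "contra_hom C X Y f \<longleftrightarrow>
     continuous_map (space_of X) (space_of Y) f \<and>
     (\<forall>g \<in> maps C (space_of X). f (contra X g) = contra Y (\<lambda>a \<in> topspace C. f (g a)))"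


section \<open>Small diagrams and their colimits\<close>

record ('j, 'm) cat_struct =
  Ob :: "'j set"
  Ar :: "'m set"
  src :: "'m \<Rightarrow> 'j"
  tgt :: "'m \<Rightarrow> 'j"
  ident :: "'j \<Rightarrow> 'm"
  cmp :: "'m \<Rightarrow> 'm \<Rightarrow> 'm"

text \<open>\<open>cmp J g f\<close> is \<open>g\<close> after \<open>f\<close>.\<close>

definition small_category :: "('j, 'm) cat_struct \<Rightarrow> bool" where
  "small_category J \<longleftrightarrow>
     (\<forall>f \<in> Ar J. src J f \<in> Ob J \<and> tgt J f \<in> Ob J) \<and>
     (\<forall>j \<in> Ob J. ident J j \<in> Ar J \<and> src J (ident J j) = j \<and> tgt J (ident J j) = j) \<and>
     (\<forall>f \<in> Ar J. \<forall>g \<in> Ar J. src J g = tgt J f \<longrightarrow>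
        cmp J g f \<in> Ar J \<and> src J (cmp J g f) = src J f \<and> tgt J (cmp J g f) = tgt J g) \<and>
     (\<forall>f \<in> Ar J. cmp J f (ident J (src J f)) = f \<and> cmp J (ident J (tgt J f)) f = f) \<and>
     (\<forall>f \<in> Ar J. \<forall>g \<in> Ar J. \<forall>h \<in> Ar J. src J g = tgt J f \<and> src J h = tgt J g \<longrightarrow>
        cmp J h (cmp J g f) = cmp J (cmp J h g) f)"

text \<open>A functor from \<open>J\<close> to \<open>C\<close>-contramodules, given by its object part \<open>D\<close> and arrow part \<open>T\<close>.\<close>

definition contra_diagram ::
    "'c topology \<Rightarrow> ('j, 'm) cat_struct \<Rightarrow> ('j \<Rightarrow> ('c, 'x) contra_struct) \<Rightarrow> ('m \<Rightarrow> 'x \<Rightarrow> 'x) \<Rightarrow> bool"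
  where
  "contra_diagram C J D T \<longleftrightarrow>
     (\<forall>j \<in> Ob J. contramodule C (D j)) \<and>
     (\<forall>f \<in> Ar J. contra_hom C (D (src J f)) (D (tgt J f)) (T f)) \<and>
     (\<forall>j \<in> Ob J. \<forall>x \<in> topspace (space_of (D j)). T (ident J j) x = x) \<and>
     (\<forall>f \<in> Ar J. \<forall>g \<in> Ar J. src J g = tgt J f \<longrightarrow>
        (\<forall>x \<in> topspace (space_of (D (src J f))). T (cmp J g f) x = T g (T f x)))"

definition contra_cocone ::
    "'c topology \<Rightarrow> ('j, 'm) cat_struct \<Rightarrow> ('j \<Rightarrow> ('c, 'x) contra_struct) \<Rightarrow> ('m \<Rightarrow> 'x \<Rightarrow> 'x) \<Rightarrow>
     ('c, 'z) contra_struct \<Rightarrow> ('j \<Rightarrow> 'x \<Rightarrow> 'z) \<Rightarrow> bool" where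
  "contra_cocone C J D T Z \<zeta> \<longleftrightarrow>
     contramodule C Z \<and>
     (\<forall>j \<in> Ob J. contra_hom C (D j) Z (\<zeta> j)) \<and>
     (\<forall>f \<in> Ar J. \<forall>x \<in> topspace (space_of (D (src J f))). \<zeta> (tgt J f) (T f x) = \<zeta> (src J f) x)"

text \<open>
  \<open>(L, \<iota>)\<close> is initial among the cocones whose apex is carried by a subset of the type \<^typ>\<open>'z\<close>.
  Taking \<^typ>\<open>'z\<close> to be the type \<^typ>\<open>'l\<close> of \<open>L\<close> itself already determines \<open>(L, \<iota>)\<close> up to a unique
  isomorphism among the candidates on \<^typ>\<open>'l\<close>. A colimit in the category of all contramodules is an
  \<open>(L, \<iota>)\<close> for which this holds at every type \<^typ>\<open>'z\<close>.
\<close>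

definition contra_colimit_wrt ::
    "'z itself \<Rightarrow> 'c topology \<Rightarrow> ('j, 'm) cat_struct \<Rightarrow> ('j \<Rightarrow> ('c, 'x) contra_struct) \<Rightarrow>
     ('m \<Rightarrow> 'x \<Rightarrow> 'x) \<Rightarrow> ('c, 'l) contra_struct \<Rightarrow> ('j \<Rightarrow> 'x \<Rightarrow> 'l) \<Rightarrow> bool" where
  "contra_colimit_wrt _ C J D T L \<iota> \<longleftrightarrow>
     contra_cocone C J D T L \<iota> \<and>
     (\<forall>(Z :: ('c, 'z) contra_struct) \<zeta>. contra_cocone C J D T Z \<zeta> \<longrightarrow>
        (\<exists>h. contra_hom C L Z h \<and>
             (\<forall>j \<in> Ob J. \<forall>x \<in> topspace (space_of (D j)). h (\<iota> j x) = \<zeta> j x) \<and>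
             (\<forall>h'. contra_hom C L Z h' \<and>
                (\<forall>j \<in> Ob J. \<forall>x \<in> topspace (space_of (D j)). h' (\<iota> j x) = \<zeta> j x) \<longrightarrow>
                (\<forall>y \<in> topspace (space_of L). h' y = h y))))"

text \<open>
  A type to carry colimits. The objects of a diagram may use any type \<^typ>\<open>'x\<close>, but a colimit is
  in general larger than the objects, and HOL has no type of all small sets. The values obtained
  from the elements of the objects by iterating the structure map are indexed by these
  well-founded expressions, which makes the type large enough. It is only a supply of points:
  the expressions carry no algebraic or topological structure.
\<close>

datatype ('c, 'j, 'x) contra_term = Elt 'j 'x | Con "'c \<Rightarrow> ('c, 'j, 'x) contra_term"

end

theory Submission
  imports Defs
begin

text \<open>
  Given a set \<open>I\<close> of cocones, evaluate the expressions of type \<^type>\<open>contra_term\<close> in each of them, and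
  call an expression good if it is built from elements of the objects by applying \<open>Con\<close> to families
  whose values depend continuously on the point of \<open>C\<close> in every cocone of \<open>I\<close>. Representatives of the
  good expressions modulo equality of all values, with the Kellification of the initial topology,
  form a contramodule \<open>L\<close> and a cocone: it is the part of the product of the apexes generated by
  the diagram. The evaluations are morphisms out of \<open>L\<close>, and a morphism out of \<open>L\<close> is determined by its
  values on the objects. So the set of all cocones on \<^type>\<open>contra_term\<close> gives a colimit among these. For
  a cocone on another type, the one-element set containing it yields a cocone on \<^type>\<open>contra_term\<close>
  that maps to it, hence the existence half of the universal property; the one-element set
  containing a colimit \<open>L\<close> itself shows that \<open>L\<close> is generated by the diagram, hence uniqueness.
\<close>


section \<open>Weakly Hausdorff spaces and Kellification\<close>

text \<open>In a Hausdorff space, a point of the closure of \<open>D\<close> is determined by the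
  traces on \<open>D\<close> of its open neighbourhoods. Moving these traces along the injection
  \<open>u\<close> gives a copy on the type that \<open>test_map\<close> requires.\<close>

lemma closure_of_small_copy:
  fixes K :: "'k topology" and u :: "'k \<Rightarrow> 'a"
  assumes K: "compact_space K" "Hausdorff_space K" and D: "D \<subseteq> topspace K" and u: "inj_on u D"
  obtains K' :: "'a set set topology" and f
  where "compact_space K'" "Hausdorff_space K'"
    and "homeomorphic_map K' (subtopology K (K closure_of D)) f"
proof -
  define cl where "cl = K closure_of D"
  define e where "e p = {u ` (N \<inter> D) | N. openin K N \<and> p \<in> N}" for p
  have "p = q" if p: "p \<in> cl" and q: "q \<in> cl" and epq: "e p = e q" for p q
  proof (rule ccontr)
    assume "p \<noteq> q"
    moreover have "p \<in> topspace K" "q \<in> topspace K"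
      using p q unfolding cl_def by (auto simp: in_closure_of)
    ultimately obtain N M where NM: "openin K N" "openin K M" "p \<in> N" "q \<in> M" "disjnt N M"
      using K(2) unfolding Hausdorff_space_def by meson
    then have "u ` (N \<inter> D) \<in> e q"
      using epq e_def by blast
    then obtain M' where M': "u ` (N \<inter> D) = u ` (M' \<inter> D)" "openin K M'" "q \<in> M'"
      by (auto simp: e_def)
    \<comment> \<open>As \<open>q\<close> is in the closure of \<open>D\<close>, some
      \<open>d\<close> in \<open>D\<close> lies in both \<open>M'\<close> and \<open>M\<close>.
      Equality of the traces puts \<open>d\<close> into \<open>N\<close> too, against disjointness
      of \<open>N\<close> and \<open>M\<close>.\<close>
    have "N \<inter> D = M' \<inter> D"
      using M'(1) u inj_on_image_eq_iff[OF u] by (metis Int_lower2)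
    moreover obtain d where "d \<in> D" "d \<in> M' \<inter> M"
      using q M' NM openin_Int[of K M' M] unfolding cl_def in_closure_of by (metis IntI)
    ultimately show False
      using NM(5) by (auto simp: disjnt_iff)
  qed
  then have inj: "inj_on e cl"
    by (simp add: inj_on_def)
  have cl: "closedin K cl" "cl \<subseteq> topspace K"
    by (auto simp: cl_def closure_of_subset_topspace)
  define S where "S = subtopology K cl"
  have topS: "topspace S = cl"
    using cl by (auto simp: S_def)
  \<comment> \<open>The topology of the closure is carried over to the codes: pulled back along the
    decoding \<open>f\<close>, it makes \<open>e\<close> and \<open>f\<close> mutually inverse
    homeomorphisms.\<close>
  define f where "f = inv_into cl e"
  define K' where "K' = pullback_topology (e ` cl) f S"
  have fe: "f (e p) = p" if "p \<in> cl" for p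
    using inj that by (simp add: f_def)
  have topK': "topspace K' = e ` cl"
    by (auto simp: K'_def topspace_pullback_topology topS fe)
  have "continuous_map K' S f"
    unfolding K'_def using continuous_map_pullback[OF continuous_map_id, of "e ` cl" f S] by simp
  moreover have "continuous_map S K' e"
    unfolding K'_def
    by (rule continuous_map_pullback') (auto simp: topS fe intro: continuous_map_eq[OF continuous_map_id])
  ultimately have "homeomorphic_maps K' S f e"
    by (auto simp: homeomorphic_maps_def topS topK' fe)
  then have h: "homeomorphic_map K' S f" and "K' homeomorphic_space S"
    by (auto simp: homeomorphic_map_maps homeomorphic_space_def)
  moreover have "compact_space S" "Hausdorff_space S"
    using K cl by (auto simp: S_def closedin_compact_space compact_space_subtopology Hausdorff_space_subtopology)
  ultimately have "compact_space K'" "Hausdorff_space K'"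
    using homeomorphic_compact_space homeomorphic_Hausdorff_space by blast+
  then show thesis
    using that h by (simp add: S_def cl_def)
qed

text \<open>One preimage of each point of the image is chosen. The closure of these choices has the
  same image as all of \<open>K\<close>, and it has a copy among the test spaces.\<close>

lemma weakly_Hausdorff_space_closedin_image:
  fixes K :: "'k topology" and X :: "'a topology"
  assumes X: "weakly_Hausdorff_space X" and K: "compact_space K" "Hausdorff_space K"
    and u: "continuous_map K X u"
  shows "closedin X (u ` topspace K)"
proof -
  define D where "D = inv_into (topspace K) u ` (u ` topspace K)"
  have D: "D \<subseteq> topspace K" "u ` D = u ` topspace K" "inj_on u D"
    by (auto simp: D_def inv_into_into f_inv_into_f image_image inj_on_def)
  obtain K' :: "'a set set topology" and f where K': "compact_space K'" "Hausdorff_space K'"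
    and f: "homeomorphic_map K' (subtopology K (K closure_of D)) f"
    using closure_of_small_copy[OF K D(1,3)] by blast
  have "continuous_map K' K f" and img: "f ` topspace K' = topspace K \<inter> K closure_of D"
    using homeomorphic_imp_continuous_map[OF f] homeomorphic_imp_surjective_map[OF f]
    by (auto simp: continuous_map_in_subtopology)
  then have "test_map X K' (u \<circ> f)"
    using K' u by (auto simp: test_map_def intro: continuous_map_compose)
  then have "closedin X ((u \<circ> f) ` topspace K')"
    using X unfolding weakly_Hausdorff_space_def by blast
  moreover have "(u \<circ> f) ` topspace K' = u ` topspace K"
    unfolding image_comp[symmetric] img
    using D closure_of_subset[OF D(1)] by blast
  ultimately show ?thesis by simp
qed

text \<open>Otherwise some \<open>p\<close> with \<open>u p\<close> in \<open>U\<close> is in the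
  closure of the complement \<open>P\<close> of the preimage. Weak Hausdorffness passes this failure
  to a subspace small enough to be a test space, where it contradicts
  \<open>k_open X U\<close>.\<close>

lemma k_open_openin_preimage:
  fixes K :: "'k topology" and X :: "'a topology"
  assumes X: "weakly_Hausdorff_space X" and U: "k_open X U"
    and K: "compact_space K" "Hausdorff_space K" and u: "continuous_map K X u"
  shows "openin K {k \<in> topspace K. u k \<in> U}"
proof -
  define P where "P = {k \<in> topspace K. u k \<notin> U}"
  have "p \<in> P" if p: "p \<in> K closure_of P" for p
  proof (rule ccontr)
    assume "p \<notin> P"
    moreover have "p \<in> topspace K"
      using p by (simp add: in_closure_of)
    ultimately have pU: "u p \<in> U"
      by (simp add: P_def)
    define D where "D = inv_into P u ` (u ` P)"
    have P: "P \<subseteq> topspace K"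
      by (auto simp: P_def)
    have D: "D \<subseteq> P" "u ` D = u ` P" "inj_on u D"
      by (auto simp: D_def inv_into_into f_inv_into_f image_image inj_on_def)
    define cl where "cl = K closure_of D"
    have cl: "closedin K cl" "D \<subseteq> cl"
      using D P by (auto simp: cl_def intro!: closure_of_subset)
    have clK: "cl \<subseteq> topspace K"
      by (simp add: cl_def closure_of_subset_topspace)
    have S: "compact_space (subtopology K cl)" "Hausdorff_space (subtopology K cl)"
      using K cl by (auto simp: closedin_compact_space compact_space_subtopology Hausdorff_space_subtopology)
    have "closedin X (u ` topspace (subtopology K cl))"
      by (rule weakly_Hausdorff_space_closedin_image[OF X S])
        (use u in \<open>rule continuous_map_from_subtopology\<close>)
    then have "closedin X (u ` cl)"
      using clK by (simp add: Int_absorb1)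
    then have "closedin K {k \<in> topspace K. u k \<in> u ` cl}"
      using u closedin_continuous_map_preimage by blast
    moreover have "P \<subseteq> {k \<in> topspace K. u k \<in> u ` cl}"
      using P D(2) cl(2) by blast
    \<comment> \<open>The point \<open>p\<close> itself need not be in \<open>cl\<close>, but the
      closed set \<open>u\<close> cl\<open>contains\<close>u \<open>P\<close> and hence
      \<open>u p\<close>. So some \<open>q\<close> in \<open>cl\<close> can replace
      \<open>p\<close>.\<close>
    ultimately have "u p \<in> u ` cl"
      using p closure_of_minimal by fastforce
    then obtain q where q: "q \<in> cl" "u q \<in> U"
      using pU by fastforce
    obtain K' :: "'a set set topology" and f where K': "compact_space K'" "Hausdorff_space K'"
      and f: "homeomorphic_map K' (subtopology K cl) f"
      unfolding cl_def using closure_of_small_copy[OF K order_trans[OF D(1) P] D(3)] by blast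
    have "continuous_map K' K f" and img: "f ` topspace K' = cl"
      using homeomorphic_imp_continuous_map[OF f] homeomorphic_imp_surjective_map[OF f] clK
      by (auto simp: continuous_map_in_subtopology)
    then have "test_map X K' (u \<circ> f)"
      using K' u by (auto simp: test_map_def intro: continuous_map_compose)
    then have "openin K' {k \<in> topspace K'. (u \<circ> f) k \<in> U}"
      using U unfolding k_open_def by blast
    then have "openin (subtopology K cl) (f ` {k \<in> topspace K'. (u \<circ> f) k \<in> U})"
      using homeomorphic_imp_open_map[OF f] by (simp add: open_map_def)
    moreover have "f ` {k \<in> topspace K'. (u \<circ> f) k \<in> U} = {k \<in> cl. u k \<in> U}"
      using img by auto
    \<comment> \<open>The preimage of \<open>U\<close> is open in \<open>cl\<close> and contains
      \<open>q\<close>, so it meets \<open>D\<close>, although \<open>D\<close> lies in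
      \<open>P\<close>.\<close>
    ultimately obtain W where "openin K W" "{k \<in> cl. u k \<in> U} = W \<inter> cl"
      by (auto simp: openin_subtopology)
    moreover from this q have "q \<in> W" by blast
    ultimately obtain d where "d \<in> D" "d \<in> W"
      using q(1) unfolding cl_def in_closure_of by blast
    then have "u d \<in> U"
      using \<open>{k \<in> cl. u k \<in> U} = W \<inter> cl\<close> cl(2) by blast
    then show False
      using \<open>d \<in> D\<close> D(1) by (auto simp: P_def)
  qed
  then have "closedin K P"
    by (metis (lifting) P_def closure_of_eq closure_of_subset mem_Collect_eq subsetI subset_antisym)
  moreover have "{k \<in> topspace K. u k \<in> U} = topspace K - P"
    by (auto simp: P_def)
  ultimately show ?thesis
    by (simp add: openin_diff)
qed

section \<open>The universal property of Kellification\<close>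

lemma continuous_map_id_Kellification: "continuous_map (Kellification X) X id"
proof -
  have "k_open X U" if "openin X U" for U
    using that openin_subset[OF that] unfolding k_open_def test_map_def
    by (auto intro: openin_continuous_map_preimage)
  then have "openin (Kellification X) {x \<in> topspace X. x \<in> U}" if "openin X U" for U
    using that openin_subset[OF that] by (simp add: openin_Kellification Collect_conj_eq Int_absorb1)
  then show ?thesis
    by (simp add: continuous_map_def)
qed

text \<open>Being k-open is defined through test maps alone, so this makes Kellification
  idempotent.\<close>

lemma test_map_Kellification: "test_map (Kellification X) K u \<longleftrightarrow> test_map X K u"
proof
  assume "test_map (Kellification X) K u"
  then show "test_map X K u"
    using continuous_map_compose[OF _ continuous_map_id_Kellification] by (fastforce simp: test_map_def)
next
  assume "test_map X K u"
  then show "test_map (Kellification X) K u"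
    by (auto simp: test_map_def continuous_map_def openin_Kellification k_open_def)
qed

lemma compactly_generated_space_Kellification: "compactly_generated_space (Kellification X)"
  by (simp add: compactly_generated_space_def topology_eq openin_Kellification k_open_def
      test_map_Kellification)

lemma weakly_Hausdorff_space_Kellification:
  assumes "weakly_Hausdorff_space X"
  shows "weakly_Hausdorff_space (Kellification X)"
  unfolding weakly_Hausdorff_space_def
proof (intro allI impI)
  fix K u assume "test_map (Kellification X) K u"
  then have "closedin X (u ` topspace K)"
    using assms by (simp add: test_map_Kellification weakly_Hausdorff_space_def)
  then have "closedin (Kellification X) {x \<in> topspace (Kellification X). id x \<in> u ` topspace K}"
    using closedin_continuous_map_preimage continuous_map_id_Kellification by blast
  moreover have "{x \<in> topspace (Kellification X). id x \<in> u ` topspace K} = u ` topspace K"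
    using closedin_subset[OF \<open>closedin X (u ` topspace K)\<close>] by auto
  ultimately show "closedin (Kellification X) (u ` topspace K)"
    by simp
qed

lemma cgwh_space_Kellification: "weakly_Hausdorff_space X \<Longrightarrow> cgwh_space (Kellification X)"
  by (simp add: cgwh_space_def compactly_generated_space_Kellification
      weakly_Hausdorff_space_Kellification)

text \<open>Composing test maps of \<open>X\<close> with \<open>f\<close> shows that preimages of
  k-open sets are k-open. The test spaces of \<open>X\<close> may have a type other than those of
  \<open>Y\<close>, so \<open>k_open_openin_preimage\<close> is applied, and with it weak
  Hausdorffness of \<open>Y\<close>.\<close>

lemma continuous_map_into_Kellification:
  assumes X: "compactly_generated_space X" and Y: "weakly_Hausdorff_space Y"
  shows "continuous_map X (Kellification Y) f \<longleftrightarrow> continuous_map X Y f"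
proof
  assume "continuous_map X (Kellification Y) f"
  then show "continuous_map X Y f"
    using continuous_map_compose[OF _ continuous_map_id_Kellification] by fastforce
next
  assume f: "continuous_map X Y f"
  have "openin X {x \<in> topspace X. f x \<in> V}" if V: "k_open Y V" for V
  proof -
    have "openin K {k \<in> topspace K. u k \<in> {x \<in> topspace X. f x \<in> V}}" if "test_map X K u" for K u
    proof -
      from that have u: "compact_space K" "Hausdorff_space K" "continuous_map K X u"
        by (auto simp: test_map_def)
      have "openin K {k \<in> topspace K. (f \<circ> u) k \<in> V}"
        using k_open_openin_preimage[OF Y V u(1,2) continuous_map_compose[OF u(3) f]] .
      moreover have "{k \<in> topspace K. (f \<circ> u) k \<in> V} =
          {k \<in> topspace K. u k \<in> {x \<in> topspace X. f x \<in> V}}"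
        using u(3) by (auto simp: continuous_map_def)
      ultimately show ?thesis by simp
    qed
    then have "k_open X {x \<in> topspace X. f x \<in> V}"
      by (auto simp: k_open_def)
    then show ?thesis
      using X by (metis compactly_generated_space_def openin_Kellification)
  qed
  then show "continuous_map X (Kellification Y) f"
    using f by (auto simp: continuous_map_def openin_Kellification)
qed

section \<open>Weak Hausdorffness from jointly injective maps\<close>

text \<open>Closed subsets of \<open>K\<close> are compact Hausdorff and so have closed images. Thus
  \<open>u\<close> is a closed map onto its image, and closed continuous images of normal Hausdorff
  spaces are Hausdorff.\<close>

lemma weakly_Hausdorff_compact_image_Hausdorff:
  fixes K :: "'k topology" and X :: "'a topology"
  assumes X: "weakly_Hausdorff_space X" and K: "compact_space K" "Hausdorff_space K"
    and u: "continuous_map K X u"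
  shows "Hausdorff_space (subtopology X (u ` topspace K))"
proof -
  let ?Y = "subtopology X (u ` topspace K)"
  have "closedin ?Y (u ` A)" if A: "closedin K A" for A
  proof -
    have "A \<subseteq> topspace K"
      using A by (rule closedin_subset)
    have "compact_space (subtopology K A)" "Hausdorff_space (subtopology K A)"
      using K A by (auto simp: closedin_compact_space compact_space_subtopology Hausdorff_space_subtopology)
    then have "closedin X (u ` topspace (subtopology K A))"
      using weakly_Hausdorff_space_closedin_image[OF X] continuous_map_from_subtopology[OF u] by blast
    then have "closedin X (u ` A)"
      using \<open>A \<subseteq> topspace K\<close> by (simp add: Int_absorb1)
    then show ?thesis
      using \<open>A \<subseteq> topspace K\<close> by (simp add: closedin_subset_topspace image_mono)
  qed
  then have "closed_map K ?Y u"
    by (simp add: closed_map_def)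
  moreover have "continuous_map K ?Y u"
    using u by (auto simp: continuous_map_in_subtopology)
  moreover have "u ` topspace K = topspace ?Y"
    using u by (auto simp: continuous_map_def)
  moreover have "normal_space K"
    using K compact_Hausdorff_or_regular_imp_normal_space by blast
  ultimately show ?thesis
    using normal_Hausdorff_space_closed_continuous_map_image K(2) by blast
qed

text \<open>The product of the images of \<open>K\<close> in the spaces \<open>Y i\<close> is a
  closed Hausdorff box. It contains the compact image of \<open>K\<close> under the joint map
  \<open>F\<close>, which is therefore closed; its preimage under the injective \<open>F\<close> is
  the image of \<open>K\<close> in \<open>X\<close>.\<close>

lemma weakly_Hausdorff_space_jointly_injective:
  fixes X :: "'a topology" and Y :: "'i \<Rightarrow> 'b topology"
  assumes Y: "\<And>i. i \<in> I \<Longrightarrow> weakly_Hausdorff_space (Y i)"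
    and f: "\<And>i. i \<in> I \<Longrightarrow> continuous_map X (Y i) (f i)"
    and inj: "\<And>x y. \<lbrakk>x \<in> topspace X; y \<in> topspace X; \<And>i. i \<in> I \<Longrightarrow> f i x = f i y\<rbrakk> \<Longrightarrow> x = y"
  shows "weakly_Hausdorff_space X"
  unfolding weakly_Hausdorff_space_def
proof (intro allI impI)
  fix K :: "'a set set topology" and u
  assume "test_map X K u"
  then have K: "compact_space K" "Hausdorff_space K" and u: "continuous_map K X u"
    by (auto simp: test_map_def)
  define F where "F x = (\<lambda>i\<in>I. f i x)" for x
  define S where "S i = (f i \<circ> u) ` topspace K" for i
  let ?P = "product_topology Y I"
  let ?Q = "Pi\<^sub>E I S"
  have F: "continuous_map X ?P F"
    unfolding continuous_map_componentwise
    using f by (auto simp: F_def intro: continuous_map_eq)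
  have fu: "continuous_map K (Y i) (f i \<circ> u)" if "i \<in> I" for i
    using f[OF that] u by (rule continuous_map_compose[rotated])
  have "Hausdorff_space (subtopology ?P ?Q)"
    unfolding subtopology_product_topology Hausdorff_space_product_topology
    using weakly_Hausdorff_compact_image_Hausdorff[OF Y K fu] by (simp add: S_def)
  moreover have img: "F ` u ` topspace K \<subseteq> ?Q"
    by (auto simp: F_def S_def)
  moreover have "compactin ?P (F ` u ` topspace K)"
    using K(1) u F by (meson compact_space_def image_compactin)
  ultimately have "closedin (subtopology ?P ?Q) (F ` u ` topspace K)"
    by (simp add: compactin_imp_closedin compactin_subtopology)
  moreover have "closedin ?P ?Q"
    using weakly_Hausdorff_space_closedin_image[OF Y K fu]
    by (auto simp: closedin_product_topology S_def)
  ultimately have "closedin ?P (F ` u ` topspace K)"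
    by (rule closedin_trans_full)
  then have "closedin X {x \<in> topspace X. F x \<in> F ` u ` topspace K}"
    using F closedin_continuous_map_preimage by blast
  moreover have "inj_on F (topspace X)"
    unfolding inj_on_def F_def by (metis inj restrict_apply')
  then have "{x \<in> topspace X. F x \<in> F ` u ` topspace K} = u ` topspace K"
    using u by (auto simp: inj_on_def continuous_map_def Pi_iff)
  ultimately show "closedin X (u ` topspace K)"
    by simp
qed

text \<open>The two projections are jointly injective. In a square they have a common codomain, so
  they form one family indexed by the booleans.\<close>

lemma weakly_Hausdorff_space_prod_topology:
  fixes X :: "'a topology"
  assumes "weakly_Hausdorff_space X"
  shows "weakly_Hausdorff_space (prod_topology X X)"
  by (rule weakly_Hausdorff_space_jointly_injective
        [where I = UNIV and Y = "\<lambda>_::bool. X" and f = "\<lambda>b. if b then fst else snd"])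
    (use assms in \<open>auto simp: continuous_map_fst continuous_map_snd split: if_splits
      intro: prod_eqI dest: meta_spec[of _ True] meta_spec[of _ False]\<close>)

text \<open>Evaluations at points are jointly injective, and they are continuous because singletons
  are compact.\<close>

lemma weakly_Hausdorff_space_compact_open_topology:
  assumes X: "weakly_Hausdorff_space X"
  shows "weakly_Hausdorff_space (compact_open_topology C X)"
proof (rule weakly_Hausdorff_space_jointly_injective
        [where I = "topspace C" and Y = "\<lambda>_. X" and f = "\<lambda>c g. g c"])
  fix c assume c: "c \<in> topspace C"
  have "openin (compact_open_topology C X) {g \<in> maps C X. g c \<in> U}" if "openin X U" for U
  proof -
    have "{g \<in> maps C X. g c \<in> U} = {g \<in> maps C X. g ` {c} \<subseteq> U}" by simp
    moreover have "compactin C {c}"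
      using c by simp
    ultimately show ?thesis
      unfolding compact_open_topology_def using that by (blast intro: topology_generated_by_Basis)
  qed
  then show "continuous_map (compact_open_topology C X) X (\<lambda>g. g c)"
    using c by (auto simp: continuous_map_def maps_def)
next
  fix g h assume "g \<in> topspace (compact_open_topology C X)" "h \<in> topspace (compact_open_topology C X)"
    and "\<And>c. c \<in> topspace C \<Longrightarrow> g c = h c"
  then show "g = h"
    by (auto simp: maps_def intro: extensionalityI)
qed (rule X)

section \<open>Functoriality of the mapping space\<close>

lemma topspace_hom_space [simp]: "topspace (hom_space C X) = maps C X"
  by (simp add: hom_space_def)

lemma restrict_in_maps: "(\<lambda>c\<in>topspace C. g c) \<in> maps C X \<longleftrightarrow> continuous_map C X g"
  by (auto simp: maps_def elim: continuous_map_eq)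

text \<open>Postcomposition pulls the subbasic set given by \<open>K\<close> and \<open>V\<close>
  back to the one given by \<open>K\<close> and the preimage of \<open>V\<close> under
  \<open>f\<close>. The universal property of Kellification does the rest.\<close>

lemma continuous_map_hom_space:
  assumes f: "continuous_map X Y f" and Y: "weakly_Hausdorff_space Y"
  shows "continuous_map (hom_space C X) (hom_space C Y) (\<lambda>g. \<lambda>c\<in>topspace C. f (g c))"
proof -
  let ?f = "\<lambda>g. \<lambda>c\<in>topspace C. f (g c)"
  have maps: "?f g \<in> maps C Y" if "g \<in> maps C X" for g
    using that continuous_map_compose[OF _ f] by (auto simp: restrict_in_maps maps_def o_def)
  have "continuous_map (compact_open_topology C X) (compact_open_topology C Y) ?f"
    unfolding compact_open_topology_def[of C Y]
  proof (rule continuous_on_generated_topo)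
    fix U assume "U \<in> {{g \<in> maps C Y. g ` K \<subseteq> U} | K U. compactin C K \<and> openin Y U}"
    then obtain K V where U: "U = {g \<in> maps C Y. g ` K \<subseteq> V}" and K: "compactin C K" and V: "openin Y V"
      by blast
    have "K \<subseteq> topspace C"
      using K by (rule compactin_subset_topspace)
    then have "?f -` U \<inter> topspace (compact_open_topology C X) =
        {g \<in> maps C X. g ` K \<subseteq> {x \<in> topspace X. f x \<in> V}}"
      unfolding U using maps by (auto simp: maps_def dest: continuous_map_funspace)
    moreover have "openin X {x \<in> topspace X. f x \<in> V}"
      using f V openin_continuous_map_preimage by blast
    ultimately show "openin (compact_open_topology C X) (?f -` U \<inter> topspace (compact_open_topology C X))"
      unfolding compact_open_topology_def using K by (auto intro!: topology_generated_by_Basis)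
  next
    \<comment> \<open>Taking both sets empty makes the whole of \<open>maps C Y\<close> subbasic, so
      the subbasis covers it.\<close>
    have "maps C Y \<in> {{g \<in> maps C Y. g ` K \<subseteq> U} | K U. compactin C K \<and> openin Y U}"
      by (rule CollectI, rule exI [of _ "{}"], rule exI [of _ "{}"]) auto
    then show "?f ` topspace (compact_open_topology C X) \<subseteq>
        \<Union> {{g \<in> maps C Y. g ` K \<subseteq> U} | K U. compactin C K \<and> openin Y U}"
      using maps by auto
  qed
  then have "continuous_map (hom_space C X) (compact_open_topology C Y) ?f"
    unfolding hom_space_def using continuous_map_compose[OF continuous_map_id_Kellification] by fastforce
  then show ?thesis
    unfolding hom_space_def
    by (simp add: continuous_map_into_Kellification compactly_generated_space_Kellification
        weakly_Hausdorff_space_compact_open_topology Y)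
qed


section \<open>Morphisms of contramodules\<close>

lemma contra_hom_compose:
  assumes f: "contra_hom C X Y f" and g: "contra_hom C Y Z g"
  shows "contra_hom C X Z (g \<circ> f)"
proof -
  have "(g \<circ> f) (contra X k) = contra Z (\<lambda>c\<in>topspace C. (g \<circ> f) (k c))"
    if k: "k \<in> maps C (space_of X)" for k
  proof -
    have "(\<lambda>c\<in>topspace C. f (k c)) \<in> maps C (space_of Y)"
      using k f continuous_map_compose by (fastforce simp: restrict_in_maps maps_def contra_hom_def o_def)
    then have "g (contra Y (\<lambda>c\<in>topspace C. f (k c))) =
        contra Z (\<lambda>c\<in>topspace C. g ((\<lambda>c\<in>topspace C. f (k c)) c))"
      using g by (simp add: contra_hom_def)
    also have "(\<lambda>c\<in>topspace C. g ((\<lambda>c\<in>topspace C. f (k c)) c)) = (\<lambda>c\<in>topspace C. (g \<circ> f) (k c))"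
      by auto
    also have "contra Y (\<lambda>c\<in>topspace C. f (k c)) = f (contra X k)"
      using f k by (simp add: contra_hom_def)
    finally show ?thesis
      by (simp only: o_apply)
  qed
  then show ?thesis
    using f g by (auto simp: contra_hom_def intro: continuous_map_compose)
qed

lemma contra_hom_id: "contra_hom C X X id"
proof -
  have "(\<lambda>c\<in>topspace C. g c) = g" if "g \<in> maps C (space_of X)" for g
    using that by (auto simp: maps_def extensional_restrict)
  then show ?thesis
    by (auto simp: contra_hom_def)
qed


section \<open>The contramodule generated by a diagram in a family of cocones\<close>

text \<open>Restriction to \<open>topspace C\<close> makes the argument of \<open>contra\<close>
  extensional, as membership in \<open>maps\<close> requires. Expressions with discontinuous
  families also get a value; \<open>good\<close> excludes them later.\<close>

primrec contra_eval ::
    "'c topology \<Rightarrow> ('c, 'w) contra_struct \<Rightarrow> ('j \<Rightarrow> 'x \<Rightarrow> 'w) \<Rightarrow> ('c, 'j, 'x) contra_term \<Rightarrow> 'w" where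
  "contra_eval C Z \<zeta> (Elt j x) = \<zeta> j x"
| "contra_eval C Z \<zeta> (Con k) = contra Z (\<lambda>c\<in>topspace C. contra_eval C Z \<zeta> (k c))"

locale cocone_family =
  fixes C :: "'c topology"
    and J :: "('j, 'm) cat_struct"
    and D :: "'j \<Rightarrow> ('c, 'x) contra_struct"
    and T :: "'m \<Rightarrow> 'x \<Rightarrow> 'x"
    and I :: "(('c, 'w) contra_struct \<times> ('j \<Rightarrow> 'x \<Rightarrow> 'w)) set"
  assumes cgwh_C: "cgwh_space C"
    and diagram: "contra_diagram C J D T"
    and cocones: "i \<in> I \<Longrightarrow> contra_cocone C J D T (fst i) (snd i)"
begin

abbreviation ev :: "('c, 'w) contra_struct \<times> ('j \<Rightarrow> 'x \<Rightarrow> 'w) \<Rightarrow> ('c, 'j, 'x) contra_term \<Rightarrow> 'w" where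
  "ev i \<equiv> contra_eval C (fst i) (snd i)"

abbreviation apex :: "('c, 'w) contra_struct \<times> ('j \<Rightarrow> 'x \<Rightarrow> 'w) \<Rightarrow> 'w topology" where
  "apex i \<equiv> space_of (fst i)"

text \<open>Continuity is demanded of the values in the cocones because the space of representatives
  is only built from the good expressions afterwards.\<close>

inductive good :: "('c, 'j, 'x) contra_term \<Rightarrow> bool" where
  Elt: "\<lbrakk>j \<in> Ob J; x \<in> topspace (space_of (D j))\<rbrakk> \<Longrightarrow> good (Elt j x)"
| Con: "\<lbrakk>\<And>c. c \<in> topspace C \<Longrightarrow> good (k c); \<And>i. i \<in> I \<Longrightarrow> continuous_map C (apex i) (\<lambda>c. ev i (k c))\<rbrakk>
     \<Longrightarrow> good (Con k)"

text \<open>The choice depends on the values of \<open>t\<close> only, so \<open>rep_cong\<close>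
  holds for arbitrary expressions, good or not.\<close>

definition rep :: "('c, 'j, 'x) contra_term \<Rightarrow> ('c, 'j, 'x) contra_term" where
  "rep t = (SOME s. good s \<and> (\<forall>i\<in>I. ev i s = ev i t))"

definition points :: "('c, 'j, 'x) contra_term set" where
  "points = rep ` {t. good t}"

definition initial_topology :: "('c, 'j, 'x) contra_term topology" where
  "initial_topology = pullback_topology points (\<lambda>t. \<lambda>i\<in>I. ev i t) (product_topology apex I)"

definition generated :: "('c, ('c, 'j, 'x) contra_term) contra_struct" where
  "generated = \<lparr>space_of = Kellification initial_topology, contra = (\<lambda>g. rep (Con g))\<rparr>"

definition incl :: "'j \<Rightarrow> 'x \<Rightarrow> ('c, 'j, 'x) contra_term" where
  "incl j x = rep (Elt j x)"

section \<open>Representatives and their values\<close>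

lemma rep_cong: "(\<And>i. i \<in> I \<Longrightarrow> ev i s = ev i t) \<Longrightarrow> rep s = rep t"
  by (simp add: rep_def)

lemma
  assumes "good t"
  shows good_rep: "good (rep t)" and ev_rep: "i \<in> I \<Longrightarrow> ev i (rep t) = ev i t"
proof -
  have "good (rep t) \<and> (\<forall>i\<in>I. ev i (rep t) = ev i t)"
    unfolding rep_def by (rule someI[of _ t]) (simp add: assms)
  then show "good (rep t)" "i \<in> I \<Longrightarrow> ev i (rep t) = ev i t" by auto
qed

lemma rep_in_points: "good t \<Longrightarrow> rep t \<in> points"
  by (simp add: points_def)

lemma good_points: "t \<in> points \<Longrightarrow> good t"
  by (auto simp: points_def good_rep)

lemma rep_points: "t \<in> points \<Longrightarrow> rep t = t"
  by (auto simp: points_def intro!: rep_cong ev_rep)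

lemma points_eqI: "\<lbrakk>s \<in> points; t \<in> points; \<And>i. i \<in> I \<Longrightarrow> ev i s = ev i t\<rbrakk> \<Longrightarrow> s = t"
  using rep_points rep_cong by metis

lemma contramodule_apex: "i \<in> I \<Longrightarrow> contramodule C (fst i)"
  using cocones by (simp add: contra_cocone_def)

lemma weakly_Hausdorff_apex: "i \<in> I \<Longrightarrow> weakly_Hausdorff_space (apex i)"
  using contramodule_apex by (simp add: contramodule_def cgwh_space_def)

lemma contra_apex: "i \<in> I \<Longrightarrow> continuous_map (hom_space C (apex i)) (apex i) (contra (fst i))"
  using contramodule_apex by (simp add: contramodule_def)

lemma ev_good: "good t \<Longrightarrow> i \<in> I \<Longrightarrow> ev i t \<in> topspace (apex i)"
proof (induction t rule: good.induct)
  case (Elt j x)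
  then have "continuous_map (space_of (D j)) (apex i) (snd i j)"
    using cocones by (auto simp: contra_cocone_def contra_hom_def)
  then show ?case
    using Elt by (auto simp: continuous_map_def)
next
  case (Con k)
  then show ?case
    using continuous_map_funspace[OF contra_apex[OF Con.prems]] by (auto simp: restrict_in_maps)
qed

section \<open>The topology on representatives\<close>

lemma topspace_initial: "topspace initial_topology = points"
  by (auto simp: initial_topology_def topspace_pullback_topology ev_good good_points)

lemma topspace_generated [simp]: "topspace (space_of generated) = points"
  by (simp add: generated_def topspace_initial)

lemma continuous_map_ev_initial: "i \<in> I \<Longrightarrow> continuous_map initial_topology (apex i) (ev i)"
  unfolding initial_topology_def
  using continuous_map_pullback[OF continuous_map_product_projection[of i I apex],
      of points "\<lambda>t. \<lambda>i\<in>I. ev i t"]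
  by (auto simp: o_def)

lemma weakly_Hausdorff_initial: "weakly_Hausdorff_space initial_topology"
  by (rule weakly_Hausdorff_space_jointly_injective[where I = I and Y = apex and f = ev])
    (auto simp: weakly_Hausdorff_apex continuous_map_ev_initial topspace_initial intro: points_eqI)

lemma cgwh_generated: "cgwh_space (space_of generated)"
  by (simp add: generated_def cgwh_space_Kellification weakly_Hausdorff_initial)

text \<open>Evaluations detect continuity into the initial topology, and Kellification does not
  change the continuous maps from a compactly generated space.\<close>

lemma continuous_map_into_generated:
  assumes W: "compactly_generated_space W" and f: "f \<in> topspace W \<rightarrow> points"
    and ev: "\<And>i. i \<in> I \<Longrightarrow> continuous_map W (apex i) (\<lambda>w. ev i (f w))"
  shows "continuous_map W (space_of generated) f"
proof -
  have "continuous_map W initial_topology f"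
    unfolding initial_topology_def
    by (rule continuous_map_pullback') (use f ev in \<open>auto simp: continuous_map_componentwise\<close>)
  then show ?thesis
    by (simp add: generated_def continuous_map_into_Kellification[OF W weakly_Hausdorff_initial])
qed

lemma continuous_map_ev: "i \<in> I \<Longrightarrow> continuous_map (space_of generated) (apex i) (ev i)"
  using continuous_map_compose[OF continuous_map_id_Kellification continuous_map_ev_initial]
  by (simp add: generated_def)

lemma continuous_map_ev_comp:
  "\<lbrakk>continuous_map W (space_of generated) g; i \<in> I\<rbrakk> \<Longrightarrow> continuous_map W (apex i) (\<lambda>w. ev i (g w))"
  using continuous_map_compose[OF _ continuous_map_ev] by (fastforce simp: o_def)

section \<open>The structure map and the contramodule axioms\<close>

lemma good_Con:
  assumes "g \<in> maps C (space_of generated)"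
  shows "good (Con g)"
proof (rule good.Con)
  from assms have g: "continuous_map C (space_of generated) g"
    by (simp add: maps_def)
  show "good (g c)" if "c \<in> topspace C" for c
    using continuous_map_funspace[OF g] that by (auto intro: good_points)
  show "continuous_map C (apex i) (\<lambda>c. ev i (g c))" if "i \<in> I" for i
    using g that by (rule continuous_map_ev_comp)
qed

lemma contra_generated: "contra generated g = rep (Con g)"
  by (simp add: generated_def)

lemma contra_in_points: "g \<in> maps C (space_of generated) \<Longrightarrow> contra generated g \<in> points"
  by (simp add: contra_generated rep_in_points good_Con)

lemma ev_contra:
  "\<lbrakk>g \<in> maps C (space_of generated); i \<in> I\<rbrakk> \<Longrightarrow>
     ev i (contra generated g) = contra (fst i) (\<lambda>c\<in>topspace C. ev i (g c))"
  by (simp add: contra_generated ev_rep good_Con)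

lemma contra_hom_ev: "i \<in> I \<Longrightarrow> contra_hom C generated (fst i) (ev i)"
  by (simp add: contra_hom_def ev_contra continuous_map_ev)

text \<open>Followed by \<open>ev i\<close>, the structure map becomes postcomposition with
  \<open>ev i\<close> followed by the structure map of the apex, and both of these are
  continuous.\<close>

lemma continuous_map_contra_generated:
  "continuous_map (hom_space C (space_of generated)) (space_of generated) (contra generated)"
proof (rule continuous_map_into_generated)
  show "compactly_generated_space (hom_space C (space_of generated))"
    by (simp add: hom_space_def compactly_generated_space_Kellification)
  show "contra generated \<in> topspace (hom_space C (space_of generated)) \<rightarrow> points"
    using contra_in_points by auto
  fix i assume i: "i \<in> I"
  have "continuous_map (hom_space C (space_of generated)) (apex i)
      (contra (fst i) \<circ> (\<lambda>g. \<lambda>c\<in>topspace C. ev i (g c)))"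
    by (rule continuous_map_compose[OF continuous_map_hom_space contra_apex])
      (simp_all add: i continuous_map_ev weakly_Hausdorff_apex)
  then show "continuous_map (hom_space C (space_of generated)) (apex i) (\<lambda>g. ev i (contra generated g))"
    by (rule continuous_map_eq) (simp add: ev_contra i)
qed

lemma continuous_map_into_k_prod:
  assumes "continuous_map C C f" "continuous_map C C g"
  shows "continuous_map C (k_prod C C) (\<lambda>c. (f c, g c))"
  using assms cgwh_C
  by (simp add: k_prod_def cgwh_space_def continuous_map_into_Kellification
      weakly_Hausdorff_space_prod_topology continuous_map_pairedI)

text \<open>Both equations are checked after evaluation in each cocone, where they become the axioms
  of the apex.\<close>

lemma contramodule_generated: "contramodule C generated"
  unfolding contramodule_def
proof (intro conjI ballI allI impI)
  show "cgwh_space (space_of generated)"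
    by (rule cgwh_generated)
  show "continuous_map (hom_space C (space_of generated)) (space_of generated) (contra generated)"
    by (rule continuous_map_contra_generated)
next
  fix t assume "t \<in> topspace (space_of generated)"
  then have t: "t \<in> points" by simp
  then have const: "(\<lambda>a\<in>topspace C. t) \<in> maps C (space_of generated)"
    by (simp add: restrict_in_maps)
  show "contra generated (\<lambda>a\<in>topspace C. t) = t"
  proof (rule points_eqI[OF contra_in_points[OF const] t])
    fix i assume i: "i \<in> I"
    have "(\<lambda>c\<in>topspace C. ev i ((\<lambda>a\<in>topspace C. t) c)) = (\<lambda>c\<in>topspace C. ev i t)"
      by auto
    then show "ev i (contra generated (\<lambda>a\<in>topspace C. t)) = ev i t"
      using contramodule_apex[OF i] ev_good[OF good_points[OF t] i]
      by (simp add: ev_contra[OF const i] contramodule_def)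
  qed
next
  fix \<gamma> assume \<gamma>: "continuous_map (k_prod C C) (space_of generated) \<gamma>"
  have slice: "(\<lambda>b\<in>topspace C. \<gamma> (a, b)) \<in> maps C (space_of generated)" if "a \<in> topspace C" for a
    using continuous_map_compose[OF continuous_map_into_k_prod \<gamma>, of "\<lambda>_. a" "\<lambda>b. b"] that
    by (simp add: restrict_in_maps o_def)
  txt \<open>
    Whether \<open>a \<mapsto> \<theta>(\<gamma>(a, -))\<close> is continuous need not be known: both sides represent terms with the
    same values, and the values alone determine the representative.
  \<close>
  show "contra generated (\<lambda>a\<in>topspace C. contra generated (\<lambda>b\<in>topspace C. \<gamma> (a, b))) =
        contra generated (\<lambda>a\<in>topspace C. \<gamma> (a, a))"
    unfolding contra_generated[of "restrict _ _"]
  proof (rule rep_cong)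
    fix i assume i: "i \<in> I"
    have "ev i (Con (\<lambda>a\<in>topspace C. contra generated (\<lambda>b\<in>topspace C. \<gamma> (a, b)))) =
        contra (fst i) (\<lambda>a\<in>topspace C. contra (fst i) (\<lambda>b\<in>topspace C. ev i (\<gamma> (a, b))))"
      by (simp add: ev_contra[OF slice i] cong: restrict_cong)
    \<comment> \<open>This is the axiom of the apex for the continuous map
      \<open>\<lambda>p. ev i (\<gamma> p)\<close>.\<close>
    also have "\<dots> = contra (fst i) (\<lambda>a\<in>topspace C. ev i (\<gamma> (a, a)))"
      using contramodule_apex[OF i] continuous_map_ev_comp[OF \<gamma> i] unfolding contramodule_def by blast
    also have "\<dots> = ev i (Con (\<lambda>a\<in>topspace C. \<gamma> (a, a)))"
      by (simp cong: restrict_cong)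
    finally show "ev i (Con (\<lambda>a\<in>topspace C. rep (Con (\<lambda>b\<in>topspace C. \<gamma> (a, b))))) =
        ev i (Con (\<lambda>a\<in>topspace C. \<gamma> (a, a)))"
      by (simp add: contra_generated)
  qed
qed

section \<open>The cocone of inclusions and uniqueness of morphisms\<close>

lemma ev_incl:
  "\<lbrakk>j \<in> Ob J; x \<in> topspace (space_of (D j)); i \<in> I\<rbrakk> \<Longrightarrow> ev i (incl j x) = snd i j x"
  by (simp add: incl_def ev_rep good.Elt)

text \<open>The legs of each cocone are morphisms, so \<open>Elt j (contra (D j) g)\<close> and the
  \<open>Con\<close> of the included family have the same values and hence the same
  representative.\<close>

lemma contra_hom_incl:
  assumes j: "j \<in> Ob J"
  shows "contra_hom C (D j) generated (incl j)"
proof -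
  have hom: "contra_hom C (D j) (fst i) (snd i j)" if "i \<in> I" for i
    using cocones[OF that] j by (simp add: contra_cocone_def)
  have Dj: "contramodule C (D j)"
    using diagram j by (simp add: contra_diagram_def)
  have "continuous_map (space_of (D j)) (space_of generated) (incl j)"
  proof (rule continuous_map_into_generated)
    show "compactly_generated_space (space_of (D j))"
      using Dj by (simp add: contramodule_def cgwh_space_def)
    show "incl j \<in> topspace (space_of (D j)) \<rightarrow> points"
      using j by (auto simp: incl_def intro!: rep_in_points intro: good.Elt)
    show "continuous_map (space_of (D j)) (apex i) (\<lambda>x. ev i (incl j x))" if i: "i \<in> I" for i
      using hom[OF i] unfolding contra_hom_def
      by (auto intro: continuous_map_eq simp: ev_incl[OF j _ i])
  qed
  moreover have "incl j (contra (D j) g) = contra generated (\<lambda>a\<in>topspace C. incl j (g a))"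
    if g: "g \<in> maps C (space_of (D j))" for g
    unfolding contra_generated incl_def[of j "contra (D j) g"]
  proof (rule rep_cong)
    fix i assume i: "i \<in> I"
    have "ev i (incl j (g a)) = snd i j (g a)" if "a \<in> topspace C" for a
      using g that by (auto simp: ev_incl[OF j _ i] maps_def continuous_map_def Pi_iff)
    then show "ev i (Elt j (contra (D j) g)) = ev i (Con (\<lambda>a\<in>topspace C. incl j (g a)))"
      using hom[OF i] g by (simp add: contra_hom_def cong: restrict_cong)
  qed
  ultimately show ?thesis
    by (simp add: contra_hom_def)
qed

lemma contra_cocone_generated: "contra_cocone C J D T generated incl"
  unfolding contra_cocone_def incl_def
proof (intro conjI ballI contramodule_generated contra_hom_incl[unfolded incl_def])
  fix f x assume "f \<in> Ar J" "x \<in> topspace (space_of (D (src J f)))"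
  then show "rep (Elt (tgt J f) (T f x)) = rep (Elt (src J f) x)"
    using cocones by (intro rep_cong) (simp add: contra_cocone_def)
qed

text \<open>By induction on good expressions: the representative of \<open>Con k\<close> is the
  structure map applied to the family of representatives of \<open>k c\<close>, and morphisms
  commute with structure maps.\<close>

lemma contra_hom_generated_eq:
  assumes h: "contra_hom C generated Z h" and h': "contra_hom C generated Z h'"
    and eq: "\<And>j x. \<lbrakk>j \<in> Ob J; x \<in> topspace (space_of (D j))\<rbrakk> \<Longrightarrow> h (incl j x) = h' (incl j x)"
    and t: "t \<in> topspace (space_of generated)"
  shows "h t = h' t"
proof -
  have "h (rep t) = h' (rep t)" if "good t" for t
    using that
  proof (induction t rule: good.induct)
    case (Elt j x)
    then show ?case
      using eq by (simp add: incl_def)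
  next
    case (Con k)
    define g where "g = (\<lambda>c\<in>topspace C. rep (k c))"
    have ev_k: "ev i (rep (k c)) = ev i (k c)" if "c \<in> topspace C" "i \<in> I" for i c
      using Con.hyps(1) that by (simp add: ev_rep)
    \<comment> \<open>Passing to representatives keeps all values, so the continuity condition in
      \<open>good\<close> is exactly what is needed here.\<close>
    have "continuous_map C (space_of generated) (\<lambda>c. rep (k c))"
    proof (rule continuous_map_into_generated)
      show "compactly_generated_space C"
        using cgwh_C by (simp add: cgwh_space_def)
      show "(\<lambda>c. rep (k c)) \<in> topspace C \<rightarrow> points"
        using Con.hyps(1) by (auto intro: rep_in_points)
      show "continuous_map C (apex i) (\<lambda>c. ev i (rep (k c)))" if "i \<in> I" for i
        using Con.hyps(2)[OF that] by (rule continuous_map_eq) (simp add: ev_k that)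
    qed
    then have g: "g \<in> maps C (space_of generated)"
      by (simp add: g_def restrict_in_maps)
    have "rep (Con k) = contra generated g"
      unfolding contra_generated by (rule rep_cong) (simp add: g_def ev_k cong: restrict_cong)
    moreover have "(\<lambda>c\<in>topspace C. h (g c)) = (\<lambda>c\<in>topspace C. h' (g c))"
      using Con.IH by (auto simp: g_def)
    ultimately show ?case
      using h h' g by (simp add: contra_hom_def)
  qed
  with t show ?thesis
    using good_points rep_points by (metis topspace_generated)
qed

end


section \<open>Colimits\<close>

lemma contra_colimit_wrt_induced:
  fixes Z :: "('c, 'z) contra_struct"
  assumes "contra_colimit_wrt TYPE('z) C J D T L \<iota>" and "contra_cocone C J D T Z \<zeta>"
  obtains h where "contra_hom C L Z h"
    and "\<And>j x. \<lbrakk>j \<in> Ob J; x \<in> topspace (space_of (D j))\<rbrakk> \<Longrightarrow> h (\<iota> j x) = \<zeta> j x"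
    and "\<And>h' y. \<lbrakk>contra_hom C L Z h'; y \<in> topspace (space_of L);
           \<And>j x. \<lbrakk>j \<in> Ob J; x \<in> topspace (space_of (D j))\<rbrakk> \<Longrightarrow> h' (\<iota> j x) = \<zeta> j x\<rbrakk> \<Longrightarrow> h' y = h y"
proof -
  from assms(1)[unfolded contra_colimit_wrt_def, THEN conjunct2, THEN spec, THEN spec, THEN mp, OF assms(2)]
  obtain h where h: "contra_hom C L Z h \<and>
             (\<forall>j \<in> Ob J. \<forall>x \<in> topspace (space_of (D j)). h (\<iota> j x) = \<zeta> j x) \<and>
             (\<forall>h'. contra_hom C L Z h' \<and>
                (\<forall>j \<in> Ob J. \<forall>x \<in> topspace (space_of (D j)). h' (\<iota> j x) = \<zeta> j x) \<longrightarrow>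
                (\<forall>y \<in> topspace (space_of L). h' y = h y))"
    by (rule exE)
  show thesis
    by (rule that[of h]) (use h in blast)+
qed

theorem theorem5:
  fixes C :: "'c topology"
    and J :: "('j, 'm) cat_struct"
    and D :: "'j \<Rightarrow> ('c, 'x) contra_struct"
    and T :: "'m \<Rightarrow> 'x \<Rightarrow> 'x"
  assumes "cgwh_space C"
    and "small_category J"
    and "contra_diagram C J D T"
  shows "(\<exists>(L :: ('c, ('c, 'j, 'x) contra_term) contra_struct) \<iota>.
            contra_colimit_wrt TYPE(('c, 'j, 'x) contra_term) C J D T L \<iota>) \<and>
         (\<forall>(L :: ('c, ('c, 'j, 'x) contra_term) contra_struct) \<iota>.
            contra_colimit_wrt TYPE(('c, 'j, 'x) contra_term) C J D T L \<iota> \<longrightarrow>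
            contra_colimit_wrt TYPE('z) C J D T L \<iota>)"
proof (intro conjI allI impI)
  \<comment> \<open>Every cocone on this type belongs to \<open>I\<close>, so its own evaluation is
    the induced morphism.\<close>
  define I :: "(('c, ('c, 'j, 'x) contra_term) contra_struct \<times> ('j \<Rightarrow> 'x \<Rightarrow> ('c, 'j, 'x) contra_term)) set"
    where "I = {(Z, \<zeta>). contra_cocone C J D T Z \<zeta>}"
  interpret cocone_family C J D T I
    by unfold_locales (use assms in \<open>auto simp: I_def\<close>)
  have "contra_colimit_wrt TYPE(('c, 'j, 'x) contra_term) C J D T generated incl"
    unfolding contra_colimit_wrt_def
  proof (intro conjI allI impI contra_cocone_generated)
    fix Z :: "('c, ('c, 'j, 'x) contra_term) contra_struct" and \<zeta>
    assume "contra_cocone C J D T Z \<zeta>"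
    then have i: "(Z, \<zeta>) \<in> I"
      by (simp add: I_def)
    show "\<exists>h. contra_hom C generated Z h \<and>
             (\<forall>j \<in> Ob J. \<forall>x \<in> topspace (space_of (D j)). h (incl j x) = \<zeta> j x) \<and>
             (\<forall>h'. contra_hom C generated Z h' \<and>
                (\<forall>j \<in> Ob J. \<forall>x \<in> topspace (space_of (D j)). h' (incl j x) = \<zeta> j x) \<longrightarrow>
                (\<forall>y \<in> topspace (space_of generated). h' y = h y))"
    proof (intro exI[of _ "ev (Z, \<zeta>)"] conjI ballI allI impI)
      show hom: "contra_hom C generated Z (ev (Z, \<zeta>))"
        using contra_hom_ev[OF i] by simp
      show incl: "ev (Z, \<zeta>) (incl j x) = \<zeta> j x" if "j \<in> Ob J" "x \<in> topspace (space_of (D j))" for j x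
        using ev_incl[OF that i] by simp
      show "h' y = ev (Z, \<zeta>) y" if "contra_hom C generated Z h' \<and>
          (\<forall>j \<in> Ob J. \<forall>x \<in> topspace (space_of (D j)). h' (incl j x) = \<zeta> j x)"
          and y: "y \<in> topspace (space_of generated)" for h' y
        by (rule contra_hom_generated_eq[OF _ hom _ y]) (use that incl in simp_all)
    qed
  qed
  then show "\<exists>(L :: ('c, ('c, 'j, 'x) contra_term) contra_struct) \<iota>.
      contra_colimit_wrt TYPE(('c, 'j, 'x) contra_term) C J D T L \<iota>"
    by blast
next
  fix L :: "('c, ('c, 'j, 'x) contra_term) contra_struct" and \<iota>
  assume L: "contra_colimit_wrt TYPE(('c, 'j, 'x) contra_term) C J D T L \<iota>"
  then have L_cocone: "contra_cocone C J D T L \<iota>"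
    by (simp add: contra_colimit_wrt_def)
  interpret L: cocone_family C J D T "{(L, \<iota>)}"
    by unfold_locales (use assms L_cocone in auto)
  \<comment> \<open>\<open>L.generated\<close> has the same carrier type as \<open>L\<close>, so the
    assumed universal property applies to it.\<close>
  obtain s where s: "contra_hom C L L.generated s"
    and s_incl: "\<And>j x. \<lbrakk>j \<in> Ob J; x \<in> topspace (space_of (D j))\<rbrakk> \<Longrightarrow> s (\<iota> j x) = L.incl j x"
    using contra_colimit_wrt_induced[OF L L.contra_cocone_generated] by metis
  let ?e = "contra_eval C L \<iota>"
  have e: "contra_hom C L.generated L ?e"
    using L.contra_hom_ev[of "(L, \<iota>)"] by simp
  have e_incl: "?e (L.incl j x) = \<iota> j x" if "j \<in> Ob J" "x \<in> topspace (space_of (D j))" for j x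
    using L.ev_incl[OF that, of "(L, \<iota>)"] by simp
  \<comment> \<open>Both \<open>?e \<circ> s\<close> and the identity are endomorphisms of
    \<open>L\<close> compatible with \<open>\<iota>\<close>, so both equal the induced one. Hence
    every point of \<open>L\<close> is the value of a good expression.\<close>
  have es: "?e (s y) = y" if y: "y \<in> topspace (space_of L)" for y
  proof -
    obtain h where h: "\<And>h'. \<lbrakk>contra_hom C L L h'; \<And>j x. \<lbrakk>j \<in> Ob J; x \<in> topspace (space_of (D j))\<rbrakk> \<Longrightarrow>
        h' (\<iota> j x) = \<iota> j x\<rbrakk> \<Longrightarrow> h' y = h y"
      using contra_colimit_wrt_induced[OF L L_cocone] y by metis
    have "(?e \<circ> s) y = h y"
      by (rule h[OF contra_hom_compose[OF s e]]) (simp add: s_incl e_incl)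
    also have "\<dots> = id y"
      by (rule h[OF contra_hom_id, symmetric]) simp
    finally show ?thesis by simp
  qed
  show "contra_colimit_wrt TYPE('z) C J D T L \<iota>"
    unfolding contra_colimit_wrt_def
  proof (intro conjI allI impI L_cocone)
    fix Z :: "('c, 'z) contra_struct" and \<zeta>
    assume Z: "contra_cocone C J D T Z \<zeta>"
    \<comment> \<open>\<open>Z.generated\<close> brings the cocone to the type of \<open>L\<close>;
      evaluation then leads from there to \<open>Z\<close>.\<close>
    interpret Z: cocone_family C J D T "{(Z, \<zeta>)}"
      by unfold_locales (use assms Z in auto)
    obtain r where r: "contra_hom C L Z.generated r"
      and r_incl: "\<And>j x. \<lbrakk>j \<in> Ob J; x \<in> topspace (space_of (D j))\<rbrakk> \<Longrightarrow> r (\<iota> j x) = Z.incl j x"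
      using contra_colimit_wrt_induced[OF L Z.contra_cocone_generated] by metis
    have "contra_hom C Z.generated Z (contra_eval C Z \<zeta>)"
      using Z.contra_hom_ev[of "(Z, \<zeta>)"] by simp
    then have h: "contra_hom C L Z (contra_eval C Z \<zeta> \<circ> r)"
      using r contra_hom_compose by blast
    have h_incl: "(contra_eval C Z \<zeta> \<circ> r) (\<iota> j x) = \<zeta> j x"
      if "j \<in> Ob J" "x \<in> topspace (space_of (D j))" for j x
      using Z.ev_incl[OF that, of "(Z, \<zeta>)"] by (simp add: r_incl[OF that])
    have h_unique: "h' y = (contra_eval C Z \<zeta> \<circ> r) y"
      if h': "contra_hom C L Z h'" and h'_incl: "\<forall>j \<in> Ob J. \<forall>x \<in> topspace (space_of (D j)). h' (\<iota> j x) = \<zeta> j x"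
        and y: "y \<in> topspace (space_of L)" for h' y
    proof -
      have sy: "s y \<in> topspace (space_of L.generated)"
        using continuous_map_funspace[of "space_of L"] s y unfolding contra_hom_def by blast
      \<comment> \<open>After precomposition with \<open>?e\<close>, the two morphisms start at
        \<open>L.generated\<close>, where agreement on the objects of the diagram suffices;
        \<open>es\<close> then returns to \<open>y\<close>.\<close>
      have "(h' \<circ> ?e) (s y) = ((contra_eval C Z \<zeta> \<circ> r) \<circ> ?e) (s y)"
      proof (rule L.contra_hom_generated_eq[OF contra_hom_compose[OF e h'] contra_hom_compose[OF e h] _ sy])
        fix j x assume jx: "j \<in> Ob J" "x \<in> topspace (space_of (D j))"
        show "(h' \<circ> ?e) (L.incl j x) = ((contra_eval C Z \<zeta> \<circ> r) \<circ> ?e) (L.incl j x)"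
          using h'_incl jx h_incl[OF jx] e_incl[OF jx] by simp
      qed
      then show ?thesis
        by (simp add: es[OF y])
    qed
    show "\<exists>h. contra_hom C L Z h \<and>
             (\<forall>j \<in> Ob J. \<forall>x \<in> topspace (space_of (D j)). h (\<iota> j x) = \<zeta> j x) \<and>
             (\<forall>h'. contra_hom C L Z h' \<and>
                (\<forall>j \<in> Ob J. \<forall>x \<in> topspace (space_of (D j)). h' (\<iota> j x) = \<zeta> j x) \<longrightarrow>
                (\<forall>y \<in> topspace (space_of L). h' y = h y))"
    proof (intro exI[of _ "contra_eval C Z \<zeta> \<circ> r"] conjI ballI allI impI h h_incl)
      show "h' y = (contra_eval C Z \<zeta> \<circ> r) y" if "contra_hom C L Z h' \<and>
          (\<forall>j \<in> Ob J. \<forall>x \<in> topspace (space_of (D j)). h' (\<iota> j x) = \<zeta> j x)"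
          and "y \<in> topspace (space_of L)" for h' y
        using that by (intro h_unique) (simp_all del: o_apply)
    qed
  qed
qed

end
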